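(* Let $k$ be an even positive integer, let $n=4k$, let $X=\mathbb{Z}_n$ be the dihedral quandle, let $\mathbbm{k}$ be a field of characteristic $0$, and let $A=\mathbbm{k}[X]$ be its quandle algebra. For a derivation $D$ of $A$ write $D(e_t)=\sum_{x\in\mathbb{Z}_n}c_t^x e_x$ (indices modulo $n$), and represent $D$ by the $n\times n$ matrix whose entry in row $t$ and column $x$ ($t,x=0,\dots,n-1$) is $c_t^x$. Then every derivation of $A$ satisfies $c_t^x=c_{t+k}^{x+k}$ for all $t,x$. Precisely, the derivations of $A$ can be written as matrices of the form $$D=\begin{pmatrix} U & V & -U & -V \\ -V & U & V & -U \\ -U & -V & U & V \\ V & -U & -V & U \end{pmatrix},$$ where $U$ and $V$ are $k\times k$ matrices.
   Context: A quandle is a set $X$ with a binary operation $\triangleright$ such that (I) $x\triangleright x=x$ for all $x$; (II) for all $y,z$ there is a unique $x$ with $x\triangleright y=z$; (III) $(x\triangleright y)\triangleright z=(x\triangleright z)\triangleright(y\triangleright z)$ for all $x,y,z$. The dihedral quandle $\mathbb{Z}_n$ is the set of integers modulo $n$ with $x\triangleright y=2y-x$. For a field $\mathbbm{k}$, the quandle algebra $\mathbbm{k}[X]$ is the (generally nonassociative) $\mathbbm{k}$-algebra with basis $\{e_x\}_{x\in X}$ and bilinear product determined by $e_x\cdot e_y=e_{x\triangleright y}$. A derivation of an algebra $A$ is a linear map $D:A\to A$ with $D(a\cdot b)=D(a)\cdot b+a\cdot D(b)$ for all $a,b\in A$. *)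

theory Defs
  imports "HOL-Library.Poly_Mapping" "Jordan_Normal_Form.Matrix"
begin

locale quandle =
  fixes X :: "'a set" and rop :: "'a \<Rightarrow> 'a \<Rightarrow> 'a"  (infixl "\<triangleright>" 70)
  assumes closed: "\<lbrakk>x \<in> X; y \<in> X\<rbrakk> \<Longrightarrow> x \<triangleright> y \<in> X"
    and idem: "x \<in> X \<Longrightarrow> x \<triangleright> x = x"
    and right_inv: "\<lbrakk>y \<in> X; z \<in> X\<rbrakk> \<Longrightarrow> \<exists>!x. x \<in> X \<and> x \<triangleright> y = z"
    and right_distrib: "\<lbrakk>x \<in> X; y \<in> X; z \<in> X\<rbrakk> \<Longrightarrow> (x \<triangleright> y) \<triangleright> z = (x \<triangleright> z) \<triangleright> (y \<triangleright> z)"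

(* Z_n is represented by the residues 0, ..., n - 1. *)
definition Zn :: "nat \<Rightarrow> int set"
  where "Zn n = {0..<int n}"

definition dihedral_op :: "nat \<Rightarrow> int \<Rightarrow> int \<Rightarrow> int"
  where "dihedral_op n x y = (2 * y - x) mod int n"

lemma dihedral_quandle:
  assumes "n > 0"
  shows "quandle (Zn n) (dihedral_op n)"
proof
  fix x y z
  assume x: "x \<in> Zn n" and y: "y \<in> Zn n"
  show "dihedral_op n x y \<in> Zn n"
    using assms by (simp add: Zn_def dihedral_op_def)
  show "dihedral_op n x x = x"
    using x by (simp add: Zn_def dihedral_op_def)
  show "dihedral_op n (dihedral_op n x y) z
      = dihedral_op n (dihedral_op n x z) (dihedral_op n y z)"
  proof -
    have L: "(2 * z - (2 * y - x) mod int n) mod int n = (2 * z - (2 * y - x)) mod int n"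
      by (rule mod_diff_right_eq)
    have "(2 * ((2 * z - y) mod int n) - (2 * z - x) mod int n) mod int n
        = (2 * (2 * z - y) - (2 * z - x)) mod int n"
    proof -
      have "(2 * ((2 * z - y) mod int n)) mod int n = (2 * (2 * z - y)) mod int n"
        by (rule mod_mult_right_eq)
      then show ?thesis
        by (intro mod_diff_cong) simp_all
    qed
    also have "2 * (2 * z - y) - (2 * z - x) = 2 * z - (2 * y - x)"
      by simp
    finally show ?thesis
      unfolding dihedral_op_def L by (rule sym)
  qed
next
  fix y z
  assume y: "y \<in> Zn n" and z: "z \<in> Zn n"
  show "\<exists>!x. x \<in> Zn n \<and> dihedral_op n x y = z"
  proof
    show "(2 * y - z) mod int n \<in> Zn n \<and> dihedral_op n ((2 * y - z) mod int n) y = z"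
      using assms z by (simp add: Zn_def dihedral_op_def mod_simps)
  next
    fix x
    assume "x \<in> Zn n \<and> dihedral_op n x y = z"
    then show "x = (2 * y - z) mod int n"
      by (auto simp: Zn_def dihedral_op_def mod_simps)
  qed
qed

(* The underlying vector space of k[X]: finitely supported functions X -> k, as those
   elements of the polymorphic type whose support lies in X.  The predefined product on
   this type is a convolution and is not the product of k[X]. *)
definition quandle_space :: "'a set \<Rightarrow> ('a \<Rightarrow>\<^sub>0 'k::field) set"
  where "quandle_space X = {a. Poly_Mapping.keys a \<subseteq> X}"

definition basis_vec :: "'a \<Rightarrow> ('a \<Rightarrow>\<^sub>0 'k::field)"
  where "basis_vec x = Poly_Mapping.single x 1"

definition quandle_scale :: "'k \<Rightarrow> ('a \<Rightarrow>\<^sub>0 'k::field) \<Rightarrow> ('a \<Rightarrow>\<^sub>0 'k)"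
  where "quandle_scale c a = Poly_Mapping.map (\<lambda>v. c * v) a"

definition quandle_mult ::
    "('a \<Rightarrow> 'a \<Rightarrow> 'a) \<Rightarrow> ('a \<Rightarrow>\<^sub>0 'k::field) \<Rightarrow> ('a \<Rightarrow>\<^sub>0 'k) \<Rightarrow> ('a \<Rightarrow>\<^sub>0 'k)"
  where "quandle_mult rop a b =
    (\<Sum>x\<in>Poly_Mapping.keys a. \<Sum>y\<in>Poly_Mapping.keys b.
       Poly_Mapping.single (rop x y) (Poly_Mapping.lookup a x * Poly_Mapping.lookup b y))"

lemma quandle_mult_basis:
  "quandle_mult rop (basis_vec x) (basis_vec y) = (basis_vec (rop x y) :: 'a \<Rightarrow>\<^sub>0 'k::field)"
  by (simp add: quandle_mult_def basis_vec_def)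

lemma quandle_mult_superset:
  assumes "finite S" "Poly_Mapping.keys a \<subseteq> S" "finite T" "Poly_Mapping.keys b \<subseteq> T"
  shows "quandle_mult rop a b = (\<Sum>x\<in>S. \<Sum>y\<in>T.
       Poly_Mapping.single (rop x y) (Poly_Mapping.lookup a x * Poly_Mapping.lookup b y))"
proof -
  have "(\<Sum>y\<in>Poly_Mapping.keys b.
       Poly_Mapping.single (rop x y) (Poly_Mapping.lookup a x * Poly_Mapping.lookup b y)) =
     (\<Sum>y\<in>T. Poly_Mapping.single (rop x y) (Poly_Mapping.lookup a x * Poly_Mapping.lookup b y))" for x
    by (rule sum.mono_neutral_left) (use assms in \<open>auto simp: in_keys_iff\<close>)
  then show ?thesis
    unfolding quandle_mult_def
    by (simp, intro sum.mono_neutral_left) (use assms in \<open>auto simp: in_keys_iff\<close>)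
qed

lemma lookup_quandle_scale [simp]:
  "Poly_Mapping.lookup (quandle_scale c a) x = c * Poly_Mapping.lookup a x"
  by (simp add: quandle_scale_def Poly_Mapping.map.rep_eq when_def)

lemma quandle_mult_add_left:
  "quandle_mult rop (a + a') b = quandle_mult rop a b + quandle_mult rop a' b"
proof -
  let ?S = "Poly_Mapping.keys a \<union> Poly_Mapping.keys a'" and ?T = "Poly_Mapping.keys b"
  have "Poly_Mapping.keys (a + a') \<subseteq> ?S"
    by (rule Poly_Mapping.keys_add)
  then show ?thesis
    by (simp add: quandle_mult_superset[of ?S _ ?T] lookup_add distrib_right single_add
        sum.distrib)
qed

lemma quandle_mult_add_right:
  "quandle_mult rop a (b + b') = quandle_mult rop a b + quandle_mult rop a b'"
proof -
  let ?S = "Poly_Mapping.keys a" and ?T = "Poly_Mapping.keys b \<union> Poly_Mapping.keys b'"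
  have "Poly_Mapping.keys (b + b') \<subseteq> ?T"
    by (rule Poly_Mapping.keys_add)
  then show ?thesis
    by (simp add: quandle_mult_superset[of ?S _ ?T] lookup_add distrib_left single_add
        sum.distrib)
qed

definition is_derivation ::
    "'v::ab_group_add set \<Rightarrow> ('k \<Rightarrow> 'v \<Rightarrow> 'v) \<Rightarrow> ('v \<Rightarrow> 'v \<Rightarrow> 'v) \<Rightarrow> ('v \<Rightarrow> 'v) \<Rightarrow> bool"
  where "is_derivation A scale prd D \<longleftrightarrow>
    (\<forall>a\<in>A. D a \<in> A) \<and>
    (\<forall>a\<in>A. \<forall>b\<in>A. D (a + b) = D a + D b) \<and>
    (\<forall>c. \<forall>a\<in>A. D (scale c a) = scale c (D a)) \<and>
    (\<forall>a\<in>A. \<forall>b\<in>A. D (prd a b) = prd (D a) b + prd a (D b))"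

definition quandle_derivation ::
    "'a set \<Rightarrow> ('a \<Rightarrow> 'a \<Rightarrow> 'a) \<Rightarrow> (('a \<Rightarrow>\<^sub>0 'k::field) \<Rightarrow> ('a \<Rightarrow>\<^sub>0 'k)) \<Rightarrow> bool"
  where "quandle_derivation X rop D \<longleftrightarrow>
    is_derivation (quandle_space X) quandle_scale (quandle_mult rop) D"

(* der_coeff n D t x is the coefficient of e_x in D(e_t); both indices are read modulo n. *)
definition der_coeff ::
    "nat \<Rightarrow> ((int \<Rightarrow>\<^sub>0 'k::field) \<Rightarrow> (int \<Rightarrow>\<^sub>0 'k)) \<Rightarrow> int \<Rightarrow> int \<Rightarrow> 'k"
  where "der_coeff n D t x =
    Poly_Mapping.lookup (D (basis_vec (t mod int n))) (x mod int n)"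

(* Row t holds the coordinates of D(e_t), the transpose of the usual column convention. *)
definition der_matrix ::
    "nat \<Rightarrow> ((int \<Rightarrow>\<^sub>0 'k::field) \<Rightarrow> (int \<Rightarrow>\<^sub>0 'k)) \<Rightarrow> 'k mat"
  where "der_matrix n D = mat n n (\<lambda>(t, x). der_coeff n D (int t) (int x))"

end

theory Submission
  imports Defs "HOL-Number_Theory.Residues"
begin

text \<open>
  Put a_s(j) = c_s^(s+j) and F_t(d) = a_t(d) + a_t(d+2k).  Comparing coefficients in
  D(e_s e_t) = D(e_s) e_t + e_s D(e_t) gives a_(2t-s)(j) = a_s(-j) for odd j and
  a_(2t-s)(2d) = a_s(-2d) + F_t(d).  The second relation forces F_(t+1)(d) - F_t(d) to be
  independent of t, hence 0 by periodicity in characteristic 0; so F does not depend on t and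
  a_(s+2m) = a_s.  Moreover F is odd, vanishes at odd arguments, and satisfies
  2 F(2d) = F(d) + F(d+k); induction on the 2-adic valuation and Euler's theorem modulo the
  odd part of k give F = 0.
\<close>

section \<open>Periodic functions on the integers\<close>

lemma shift_invariant_int:
  fixes f :: "int \<Rightarrow> 'a"
  assumes "\<And>u. f (u + 1) = f u"
  shows "f u = f 0"
  by (induction u rule: int_induct[where k = 0]) (use assms[of "_ - 1"] assms in auto)

lemma periodic_int_multiple:
  fixes f :: "int \<Rightarrow> 'a"
  assumes "\<And>u. f (u + p) = f u"
  shows "f (u + p * j) = f u"
proof -
  have "f (u + p * (j + 1)) = f (u + p * j)" for j
    using assms[of "u + p * j"] by (simp add: algebra_simps)
  from shift_invariant_int[of "\<lambda>j. f (u + p * j)", OF this] show ?thesis by simp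
qed

text \<open>\<open>f\<close> is an arithmetic progression that returns to its start after
  \<open>n\<close> steps, so \<open>of_nat n * \<delta> = 0\<close>; characteristic 0 forces
  \<open>\<delta> = 0\<close>.\<close>

lemma constant_increment_periodic_imp_constant:
  fixes f :: "int \<Rightarrow> 'k::field_char_0"
  assumes incr: "\<And>u. f (u + 1) - f u = \<delta>" and per: "f (int n) = f 0" and "n > 0"
  shows "f u = f 0"
proof -
  have "f (int m) = f 0 + of_nat m * \<delta>" for m
  proof (induction m)
    case (Suc m)
    have "f (int (Suc m)) = f (int m) + \<delta>"
      using incr[of "int m"] by (simp add: algebra_simps)
    with Suc show ?case by (simp add: algebra_simps)
  qed simp
  from this[of n] per \<open>n > 0\<close> have "\<delta> = 0" by simp
  with incr show ?thesis by (intro shift_invariant_int) simp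
qed

lemma doubling_average_vanishes:
  fixes F :: "int \<Rightarrow> 'k::field_char_0" and k :: nat
  assumes "k > 0"
    and per: "\<And>d. F (d + 2 * int k) = F d"
    and avg: "\<And>d. 2 * F (2 * d) = F d + F (d + int k)"
    and odd0: "\<And>d. odd d \<Longrightarrow> F d = 0"
  shows "F d = 0"
proof -
  obtain r q where k: "k = 2 ^ r * q" and q: "odd q"
    by (rule multiplicity_decompose'[of k 2]) (use \<open>k > 0\<close> in auto)
  have low: "F (2 ^ e * w) = 0" if "odd w" "e \<le> r" for e w
    using that
  proof (induction e arbitrary: w)
    case (Suc e)
    define j where "j = r - e"
    have "r = e + j" "j > 0" using Suc.prems by (auto simp: j_def)
    \<comment> \<open>As \<open>e < r\<close>, adding \<open>k\<close> preserves the 2-adic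
      valuation \<open>e\<close>, so the induction hypothesis kills both terms of the
      average.\<close>
    then have "2 ^ e * w + int k = 2 ^ e * (w + 2 ^ j * int q)"
      by (simp add: k power_add algebra_simps)
    moreover have "odd (w + 2 ^ j * int q)" using Suc.prems \<open>j > 0\<close> by simp
    ultimately show ?case
      using avg[of "2 ^ e * w"] Suc by (simp add: mult.assoc)
  qed (simp add: odd0)
  define G where "G w = F (2 ^ Suc r * w)" for w
  \<comment> \<open>Beyond valuation \<open>r\<close>, adding \<open>k\<close> brings the valuation
    down to exactly \<open>r\<close>, where \<open>low\<close> applies; one term of the average
    survives.\<close>
  have step: "2 * G (2 * w) = G w" for w
  proof -
    have "2 ^ Suc r * w + int k = 2 ^ r * (2 * w + int q)"
      by (simp add: k algebra_simps)
    moreover have "odd (2 * w + int q)" using q by simp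
    ultimately show ?thesis
      using avg[of "2 ^ Suc r * w"] low[of "2 * w + int q" r]
      by (simp add: G_def algebra_simps)
  qed
  have pow: "2 ^ m * G (2 ^ m * w) = G w" for m w
  proof (induction m)
    case (Suc m)
    have "2 ^ Suc m * G (2 ^ Suc m * w) = 2 ^ m * (2 * G (2 * (2 ^ m * w)))"
      by (simp add: mult_ac)
    then show ?case by (simp only: step Suc)
  qed simp
  \<comment> \<open>The period \<open>2 * k\<close> equals \<open>2 ^ Suc r * q\<close>, so
    \<open>G\<close> lives on residues modulo the odd number \<open>q\<close>, where 2 is
    invertible.\<close>
  have Gper: "G (w + int q * j) = G w" for w j
  proof -
    have "2 ^ Suc r * (w + int q * j) = 2 ^ Suc r * w + 2 * int k * j"
      by (simp add: k algebra_simps)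
    then show ?thesis using periodic_int_multiple[of F "2 * int k", OF per] by (simp add: G_def)
  qed
  have G0: "G w = 0" for w
  proof -
    define m where "m = totient q"
    have "m > 0" using q by (auto simp: m_def intro!: Nat.gr0I)
    have "[2 ^ m = 1] (mod q)"
      unfolding m_def using q by (intro euler_theorem) (simp add: coprime_commute)
    then have "[2 ^ m = (1::int)] (mod int q)"
      by (metis cong_int_iff of_nat_1 of_nat_numeral of_nat_power)
    then obtain j where "2 ^ m = 1 + int q * j"
      by (metis cong_iff_lin cong_sym)
    then have "2 ^ m * w = w + int q * (j * w)" by (simp add: algebra_simps)
    then have "2 ^ m * G w = G w" using pow[of m w] Gper by simp
    then have "(2 ^ m - 1) * G w = 0" by (simp add: algebra_simps)
    moreover have "(2::'k) ^ m \<noteq> 1"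
    proof
      assume "(2::'k) ^ m = 1"
      then have "of_nat (2 ^ m) = (of_nat 1 :: 'k)" by simp
      then have "(2::nat) ^ m = 1" by (simp only: of_nat_eq_iff)
      with \<open>m > 0\<close> show False by simp
    qed
    ultimately show ?thesis by simp
  qed
  show ?thesis
  proof (cases "2 ^ Suc r dvd d")
    case True
    then show ?thesis using G0 by (auto simp: G_def elim!: dvdE)
  next
    case False
    then have "d \<noteq> 0" by auto
    then obtain w where w: "d = 2 ^ multiplicity 2 d * w" "odd w"
      using multiplicity_decompose'[of d 2] by auto
    have "multiplicity 2 d \<le> r"
      using False multiplicity_dvd'[of "Suc r" 2 d] by linarith
    with low w show ?thesis by metis
  qed
qed

section \<open>Consequences of the coefficient relations\<close>

context
  fixes k :: nat and a :: "int \<Rightarrow> int \<Rightarrow> 'k::field_char_0"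
  assumes k_pos: "k > 0" and k_even: "even k"
    and per_row: "\<And>s j. a (s + 4 * int k) j = a s j"
    and per_col: "\<And>s j. a s (j + 4 * int k) = a s j"
    and rel_even: "\<And>s t d. a (2 * t - s) (2 * d) = a s (- (2 * d)) + (a t d + a t (d + 2 * int k))"
    and rel_odd: "\<And>s t j. odd j \<Longrightarrow> a (2 * t - s) j = a s (- j)"
begin

private definition F where "F t d = a t d + a t (d + 2 * int k)"

private lemma F_period: "F t (d + 2 * int k) = F t d"
  using per_col[of t d] by (simp add: F_def algebra_simps)

text \<open>Reflecting row \<open>s\<close> through \<open>s + m\<close> and through
  \<open>s\<close> itself produces the same term \<open>a s (- (2 * d))\<close>, which
  cancels.\<close>

private lemma even_difference: "a (s + 2 * m) (2 * d) - a s (2 * d) = F (s + m) d - F s d"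
  using rel_even[of "s + m" s d] rel_even[of s s d] by (simp add: F_def algebra_simps)

private lemma F_row_indep: "F t d = F 0 d"
proof (rule constant_increment_periodic_imp_constant[where n = "4 * k" and f = "\<lambda>t. F t d"])
  show "F (u + 1) d - F u d = F 1 d - F 0 d" for u
  proof -
    have "F (u + 1) d - F u d = a (u + 2) (2 * d) - a u (2 * d)"
      using even_difference[of u 1 d] by simp
    \<comment> \<open>Detour through row \<open>- u\<close>: its midpoints with rows
      \<open>u + 2\<close> and \<open>u\<close> are 1 and 0, whatever \<open>u\<close> is.\<close>
    also have "\<dots> = (a (u + 2) (2 * d) - a (- u) (2 * d)) - (a u (2 * d) - a (- u) (2 * d))"
      by simp
    also have "\<dots> = (F 1 d - F (- u) d) - (F 0 d - F (- u) d)"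
      using even_difference[of "- u" "u + 1" d] even_difference[of "- u" u d] by simp
    finally show ?thesis by simp
  qed
  show "F (int (4 * k)) d = F 0 d"
    using per_row[of 0] by (simp add: F_def)
qed (use k_pos in simp)

text \<open>Reflections through \<open>s + m\<close> and through \<open>s\<close> differ by this
  shift. For even \<open>j\<close> the extra terms \<open>F\<close> agree by row independence; for
  odd \<open>j\<close> there are none.\<close>

lemma row_shift_even: "a (s + 2 * m) j = a s j"
proof (cases "even j")
  case True
  then obtain d where "j = 2 * d" by (elim evenE)
  with even_difference[of s m d] F_row_indep[of s d] F_row_indep[of "s + m" d] show ?thesis by simp
next
  case False
  with rel_odd[of j "s + m" s] rel_odd[of j s s] show ?thesis by (simp add: algebra_simps)
qed

private lemma F_vanishes: "F t d = 0"
proof -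
  have diff: "a 0 (2 * d) - a 0 (- (2 * d)) = F 0 d" for d
    using rel_even[of 0 0 d] by (simp add: F_def)
  have F_neg: "F 0 (- d) = - F 0 d" for d
    using diff[of d] diff[of "- d"] by (simp add: algebra_simps)
  \<comment> \<open>The offsets \<open>- d + 2 * int k\<close> and \<open>- d - 2 * int k\<close>
    agree modulo the period \<open>4 * int k\<close>.\<close>
  have reflect: "F 0 (- d) = a 0 (- d) + a 0 (- (d + 2 * int k))" for d
    using per_col[of 0 "- d - 2 * int k"] by (simp add: F_def algebra_simps)
  have "F 0 d = 0"
  proof (rule doubling_average_vanishes[OF k_pos])
    show "F 0 (d + 2 * int k) = F 0 d" for d by (rule F_period)
    \<comment> \<open>Adding \<open>diff\<close> at \<open>d\<close> and at \<open>d + int k\<close>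
      gives \<open>F 0 (2 * d) - F 0 (- (2 * d))\<close>, which oddness doubles.\<close>
    show "2 * F 0 (2 * d) = F 0 d + F 0 (d + int k)" for d
      using diff[of d] diff[of "d + int k"] reflect[of "2 * d"] F_neg[of "2 * d"]
      by (simp add: F_def algebra_simps)
    \<comment> \<open>On odd arguments \<open>F 0\<close> is even by \<open>rel_odd\<close> as well
      as odd by \<open>F_neg\<close>.\<close>
    show "F 0 d = 0" if "odd d" for d
    proof -
      have "F 0 (- d) = F 0 d"
        using that rel_odd[of d 0 0] rel_odd[of "d + 2 * int k" 0 0] reflect[of d]
        by (simp add: F_def)
      with F_neg[of d] show ?thesis by simp
    qed
  qed
  then show ?thesis using F_row_indep[of t d] by simp
qed

lemma half_period_antisymmetric: "a t (d + 2 * int k) = - a t d"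
  using F_vanishes[of t d] by (simp add: F_def add_eq_0_iff)

end

section \<open>Coordinates of the Leibniz rule\<close>

lemma lookup_quandle_mult_basis_right:
  assumes "finite X" "a \<in> quandle_space X"
  shows "Poly_Mapping.lookup (quandle_mult rop a (basis_vec t)) y =
    (\<Sum>x | x \<in> X \<and> rop x t = y. Poly_Mapping.lookup a x)"
proof -
  have "quandle_mult rop a (basis_vec t) =
      (\<Sum>x\<in>X. Poly_Mapping.single (rop x t) (Poly_Mapping.lookup a x))"
    using assms by (subst quandle_mult_superset[of X _ "{t}"])
      (auto simp: quandle_space_def basis_vec_def)
  then show ?thesis
    using assms(1) by (simp add: lookup_sum lookup_single when_def sum.If_cases Int_def)
qed

lemma lookup_quandle_mult_basis_left:
  assumes "finite X" "b \<in> quandle_space X"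
  shows "Poly_Mapping.lookup (quandle_mult rop (basis_vec s) b) y =
    (\<Sum>x | x \<in> X \<and> rop s x = y. Poly_Mapping.lookup b x)"
proof -
  have "quandle_mult rop (basis_vec s) b =
      (\<Sum>x\<in>X. Poly_Mapping.single (rop s x) (Poly_Mapping.lookup b x))"
    using assms by (subst quandle_mult_superset[of "{s}" _ X])
      (auto simp: quandle_space_def basis_vec_def)
  then show ?thesis
    using assms(1) by (simp add: lookup_sum lookup_single when_def sum.If_cases Int_def)
qed

lemma dihedral_op_mod_left: "dihedral_op n (x mod int n) y = (2 * y - x) mod int n"
  unfolding dihedral_op_def by (rule mod_diff_right_eq)

lemma dihedral_op_mod_right: "dihedral_op n x (y mod int n) = (2 * y - x) mod int n"
  unfolding dihedral_op_def by (metis mod_diff_left_eq mod_mult_right_eq)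

text \<open>This compares coefficients of \<open>e_y\<close> in the Leibniz rule for
  \<open>e_s e_t\<close>. Right multiplication by \<open>e_t\<close> permutes the basis and
  contributes one coefficient; left multiplication by \<open>e_s\<close> sends \<open>x\<close> to
  \<open>2 * x - s\<close>, which need not be injective, hence the sum.\<close>

lemma der_coeff_product:
  fixes D :: "(int \<Rightarrow>\<^sub>0 'k::field) \<Rightarrow> (int \<Rightarrow>\<^sub>0 'k)"
  assumes n: "n > 0" and D: "quandle_derivation (Zn n) (dihedral_op n) D"
  shows "der_coeff n D (2 * t - s) y = der_coeff n D s (2 * t - y) +
    (\<Sum>x | x \<in> Zn n \<and> [2 * x = y + s] (mod int n). der_coeff n D t x)"
proof -
  let ?e = "\<lambda>t. basis_vec (t mod int n) :: int \<Rightarrow>\<^sub>0 'k"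
  have e: "?e t \<in> quandle_space (Zn n)" for t
    using n by (simp add: quandle_space_def basis_vec_def Zn_def)
  then have De: "D (?e t) \<in> quandle_space (Zn n)" for t
    using D by (simp add: quandle_derivation_def is_derivation_def)
  have fin: "finite (Zn n)" by (simp add: Zn_def)
  have "quandle_mult (dihedral_op n) (?e s) (?e t) = ?e (2 * t - s)"
    unfolding quandle_mult_basis by (simp add: dihedral_op_mod_right mod_diff_right_eq)
  then have "D (?e (2 * t - s)) = quandle_mult (dihedral_op n) (D (?e s)) (?e t)
      + quandle_mult (dihedral_op n) (?e s) (D (?e t))"
    using D e unfolding quandle_derivation_def is_derivation_def by metis
  then have "der_coeff n D (2 * t - s) y =
      (\<Sum>x | x \<in> Zn n \<and> dihedral_op n x (t mod int n) = y mod int n. Poly_Mapping.lookup (D (?e s)) x) +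
      (\<Sum>x | x \<in> Zn n \<and> dihedral_op n (s mod int n) x = y mod int n. Poly_Mapping.lookup (D (?e t)) x)"
    unfolding der_coeff_def
    by (simp only: lookup_add lookup_quandle_mult_basis_left[OF fin De]
        lookup_quandle_mult_basis_right[OF fin De])
  also have "{x. x \<in> Zn n \<and> dihedral_op n x (t mod int n) = y mod int n} = {(2 * t - y) mod int n}"
  proof -
    have "dihedral_op n x (t mod int n) = y mod int n \<longleftrightarrow> x mod int n = (2 * t - y) mod int n" for x
    proof -
      have "dihedral_op n x (t mod int n) = y mod int n \<longleftrightarrow> [2 * t - x = y] (mod int n)"
        by (simp add: dihedral_op_mod_right cong_def)
      also have "\<dots> \<longleftrightarrow> [x = 2 * t - y] (mod int n)"
        by (subst (2) cong_sym_eq) (simp add: cong_iff_dvd_diff algebra_simps)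
      finally show ?thesis by (simp add: cong_def)
    qed
    moreover have "x \<in> Zn n \<and> x mod int n = z mod int n \<longleftrightarrow> x = z mod int n" for x z
      using n by (auto simp: Zn_def)
    ultimately show ?thesis by blast
  qed
  also have "{x. x \<in> Zn n \<and> dihedral_op n (s mod int n) x = y mod int n}
      = {x. x \<in> Zn n \<and> [2 * x = y + s] (mod int n)}"
  proof -
    have "dihedral_op n (s mod int n) x = y mod int n \<longleftrightarrow> [2 * x - s = y] (mod int n)" for x
      by (simp add: dihedral_op_mod_left cong_def)
    then show ?thesis by (simp add: cong_iff_dvd_diff algebra_simps)
  qed
  finally show ?thesis
    by (simp add: der_coeff_def Zn_def)
qed

text \<open>With modulus \<open>2 * h\<close>, the congruence for \<open>y = 2 * x - s\<close> has
  exactly the two solutions \<open>x\<close> and \<open>x + h\<close>.\<close>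

lemma der_coeff_even:
  fixes D :: "(int \<Rightarrow>\<^sub>0 'k::field) \<Rightarrow> (int \<Rightarrow>\<^sub>0 'k)"
  assumes h: "h > 0" and D: "quandle_derivation (Zn (2 * h)) (dihedral_op (2 * h)) D"
  shows "der_coeff (2 * h) D (2 * t - s) (2 * x - s) = der_coeff (2 * h) D s (2 * t - (2 * x - s)) +
    (der_coeff (2 * h) D t x + der_coeff (2 * h) D t (x + int h))"
proof -
  let ?n = "int (2 * h)"
  have "[2 * z = 2 * x - s + s] (mod ?n) \<longleftrightarrow> [z = x] (mod int h)" for z
  proof -
    have "2 * z - (2 * x - s + s) = 2 * (z - x)" by simp
    then show ?thesis
      unfolding cong_iff_dvd_diff of_nat_mult by (simp only: of_nat_numeral dvd_mult_cancel_left) simp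
  qed
  moreover have "[z = x] (mod int h) \<longleftrightarrow> z = x mod ?n \<or> z = (x + int h) mod ?n"
    if "z \<in> Zn (2 * h)" for z
  proof
    assume "[z = x] (mod int h)"
    then obtain j where j: "z = x + int h * j" by (metis cong_iff_lin cong_sym)
    have z: "z mod ?n = z" using that by (simp add: Zn_def)
    show "z = x mod ?n \<or> z = (x + int h) mod ?n"
    proof (cases "even j")
      case True
      then obtain i where "j = 2 * i" by (rule evenE)
      with j have "z = x + ?n * i" by simp
      then have "z mod ?n = x mod ?n" by simp
      then show ?thesis using z by simp
    next
      case False
      then obtain i where "j = 2 * i + 1" by (rule oddE)
      with j have "z = (x + int h) + ?n * i" by (simp add: algebra_simps)
      then have "z mod ?n = (x + int h) mod ?n" by simp
      then show ?thesis using z by simp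
    qed
  next
    assume "z = x mod ?n \<or> z = (x + int h) mod ?n"
    then show "[z = x] (mod int h)"
      by (auto simp: cong_def mod_mod_cancel)
  qed
  ultimately have "{z. z \<in> Zn (2 * h) \<and> [2 * z = 2 * x - s + s] (mod ?n)}
      = {x mod ?n, (x + int h) mod ?n}"
    using h by (auto simp: Zn_def)
  \<comment> \<open>Distinctness ensures that the sum over this set has two summands.\<close>
  moreover have "x mod ?n \<noteq> (x + int h) mod ?n"
  proof
    assume "x mod ?n = (x + int h) mod ?n"
    then have "?n dvd (x + int h) - x" by (metis mod_eq_dvd_iff)
    with h show False by (auto dest: zdvd_imp_le)
  qed
  ultimately show ?thesis
    using der_coeff_product[OF _ D, of t s "2 * x - s"] h
    by (simp add: der_coeff_def)
qed

text \<open>Modulo an even \<open>n\<close> an odd number is never a double, so the sum in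
  \<open>der_coeff_product\<close> is empty.\<close>

lemma der_coeff_odd:
  fixes D :: "(int \<Rightarrow>\<^sub>0 'k::field) \<Rightarrow> (int \<Rightarrow>\<^sub>0 'k)"
  assumes n: "n > 0" "even n" and D: "quandle_derivation (Zn n) (dihedral_op n) D"
    and odd: "odd (y + s)"
  shows "der_coeff n D (2 * t - s) y = der_coeff n D s (2 * t - y)"
proof -
  have "\<not> [2 * x = y + s] (mod int n)" for x
  proof
    assume "[2 * x = y + s] (mod int n)"
    then have "[2 * x = y + s] (mod 2)"
      by (rule cong_dvd_modulus) (use n in simp)
    with odd show False by (auto simp: cong_def)
  qed
  then show ?thesis using der_coeff_product[OF n(1) D, of t s y] by simp
qed

section \<open>Block decomposition\<close>

text \<open>\<open>U\<close> and \<open>V\<close> are the first two blocks of the top block row.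
  \<open>anti\<close> yields its other two, and moving down by \<open>k\<close> rows replaces
  \<open>U\<close>, \<open>V\<close> by \<open>- V\<close>, \<open>U\<close>.\<close>

lemma block_form_of_shift_symmetry:
  fixes c :: "int \<Rightarrow> int \<Rightarrow> 'k::field"
  assumes shift: "\<And>t x. c (t + int k) (x + int k) = c t x"
    and anti: "\<And>t x. c t (x + 2 * int k) = - c t x"
  shows "\<exists>U V. U \<in> carrier_mat k k \<and> V \<in> carrier_mat k k \<and>
      mat (4 * k) (4 * k) (\<lambda>(t, x). c (int t) (int x)) =
        four_block_mat
          (four_block_mat U V (- V) U)
          (four_block_mat (- U) (- V) V (- U))
          (four_block_mat (- U) (- V) V (- U))
          (four_block_mat U V (- V) U)"
proof (intro exI conjI)
  let ?U = "mat k k (\<lambda>(t, x). c (int t) (int x))"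
  let ?V = "mat k k (\<lambda>(t, x). c (int t) (int x + int k))"
  show "?U \<in> carrier_mat k k" "?V \<in> carrier_mat k k" by auto
  have anti_row: "c (t + 2 * int k) x = - c t x" for t x
    using shift[of "t + int k" "x - int k"] shift[of t "x - 2 * int k"] anti[of t "x - 2 * int k"]
    by (simp add: algebra_simps)
  have row: "c (t + int k) x = - c t (x + int k)" for t x
    using shift[of t "x - int k"] anti[of t "x - int k"] by (simp add: algebra_simps)
  show "mat (4 * k) (4 * k) (\<lambda>(t, x). c (int t) (int x)) =
        four_block_mat
          (four_block_mat ?U ?V (- ?V) ?U)
          (four_block_mat (- ?U) (- ?V) ?V (- ?U))
          (four_block_mat (- ?U) (- ?V) ?V (- ?U))
          (four_block_mat ?U ?V (- ?V) ?U)" (is "_ = ?R")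
  proof (rule eq_matI)
    fix i j assume "i < dim_row ?R" "j < dim_col ?R"
    then have ij: "i < 4 * k" "j < 4 * k" by auto
    \<comment> \<open>Each index splits into a block number \<open>b\<close> and a position
      \<open>p\<close> inside the block, leaving sixteen cases.\<close>
    have blk: "\<exists>p b. i = p + b * k \<and> p < k \<and> b < 4" if "i < 4 * k" for i
      using that by (intro exI[of _ "i mod k"] exI[of _ "i div k"])
        (auto simp: less_mult_imp_div_less intro!: mod_less_divisor Nat.gr0I)
    obtain p b where p: "i = p + b * k" "p < k" "b < 4" using blk ij by metis
    obtain q d where q: "j = q + d * k" "q < k" "d < 4" using blk ij by metis
    have b: "b = 0 \<or> b = 1 \<or> b = 2 \<or> b = 3" and d: "d = 0 \<or> d = 1 \<or> d = 2 \<or> d = 3"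
      using p q by auto
    have row3: "c (t + 3 * int k) x = c t (x + int k)" for t x
      using anti_row[of "t + int k" x] row[of t x] by (simp add: algebra_simps)
    have col3: "c t (x + 3 * int k) = - c t (x + int k)" for t x
      using anti[of t "x + int k"] by (simp add: algebra_simps)
    have col2': "c t (2 * int k + x) = - c t x" for t x
      using anti[of t x] by (simp add: add.commute)
    have col3': "c t (3 * int k + x) = - c t (x + int k)" for t x
      using col3[of t x] by (simp add: add.commute)
    have col4': "c t (4 * int k + x) = c t x" for t x
      using anti[of t "x + 2 * int k"] anti[of t x] by (simp add: algebra_simps)
    show "mat (4 * k) (4 * k) (\<lambda>(t, x). c (int t) (int x)) $$ (i, j) = ?R $$ (i, j)"
      using b d ij p(2) q(2) unfolding p(1) q(1)
      by (elim disjE) (simp_all add: row row3 anti_row anti col3 col2' col3' col4')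
  qed auto
qed

theorem corollary3p11:
  fixes k n :: nat
    and D :: "(int \<Rightarrow>\<^sub>0 'k::field_char_0) \<Rightarrow> (int \<Rightarrow>\<^sub>0 'k)"
  assumes "even k" and "k > 0" and "n = 4 * k"
    and "quandle_derivation (Zn n) (dihedral_op n) D"
  shows "(\<forall>t x. der_coeff n D t x = der_coeff n D (t + int k) (x + int k)) \<and>
    (\<exists>U V. U \<in> carrier_mat k k \<and> V \<in> carrier_mat k k \<and>
      der_matrix n D =
        four_block_mat
          (four_block_mat U V (- V) U)
          (four_block_mat (- U) (- V) V (- U))
          (four_block_mat (- U) (- V) V (- U))
          (four_block_mat U V (- V) U))"
proof -
  define c where "c = der_coeff n D"
  \<comment> \<open>In terms of the offset from the diagonal, the reflection of both indices through
    \<open>t\<close> becomes \<open>j\<close> to \<open>- j\<close>, without reference to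
    \<open>t\<close>.\<close>
  define a where "a s j = c s (s + j)" for s j
  have n: "n > 0" "even n" "n = 2 * (2 * k)" "int n = 4 * int k" using assms by auto
  have c_row: "c (t + 4 * int k) x = c t x" and c_col: "c t (x + 4 * int k) = c t x" for t x
    by (simp_all add: c_def der_coeff_def n(4))
  have a_row: "a (s + 4 * int k) j = a s j" and a_col: "a s (j + 4 * int k) = a s j" for s j
    using c_row[of s "s + j + 4 * int k"] c_col[of s "s + j"] by (simp_all add: a_def algebra_simps)
  \<comment> \<open>The choice \<open>x = t + d\<close> makes the column \<open>2 * x - s\<close>
    lie at offset \<open>2 * d\<close> from row \<open>2 * t - s\<close>.\<close>
  have a_even: "a (2 * t - s) (2 * d) = a s (- (2 * d)) + (a t d + a t (d + 2 * int k))" for s t d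
    using der_coeff_even[of "2 * k" D t s "t + d"] assms(2,4) n(3)
    by (simp add: a_def c_def algebra_simps)
  have a_odd: "a (2 * t - s) j = a s (- j)" if "odd j" for s t j
    using der_coeff_odd[OF n(1,2) assms(4), of "2 * t - s + j" s t] that
    by (simp add: a_def c_def algebra_simps)
  \<comment> \<open>Evenness of \<open>k\<close> makes the shift by \<open>k\<close> one of the even
    row shifts that preserve \<open>a\<close>.\<close>
  obtain m where m: "int k = 2 * m" using assms(1) by (metis evenE even_of_nat)
  have shift: "c (t + int k) (x + int k) = c t x" for t x
    using row_shift_even[of k a t m "x - t", OF assms(2,1) a_row a_col a_even a_odd]
    by (simp add: a_def m algebra_simps)
  have anti: "c t (x + 2 * int k) = - c t x" for t x
    using half_period_antisymmetric[of k a t "x - t", OF assms(2,1) a_row a_col a_even a_odd]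
    by (simp add: a_def algebra_simps)
  have "der_matrix n D = mat (4 * k) (4 * k) (\<lambda>(t, x). c (int t) (int x))"
    unfolding der_matrix_def c_def assms(3) ..
  with block_form_of_shift_symmetry[of c k, OF shift anti] shift[symmetric]
  show ?thesis unfolding c_def by (intro conjI allI) metis+
qed

end
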